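(* For any positive integer $n$, the total number $N(P_4\times P_n)$ of connected sets of $P_4\times P_n$ is $$N(P_4\times P_n)=\sum_{k=1}^{n}(N_{4,k}-|\mathcal C'_{4,k}|)\cdot(n-k+1).$$
   Context: All graphs are finite and simple; $K_m$, $P_n$ are the complete graph and path of order $m$, $n$. The Cartesian product $G\times H$ has vertex set $V(G)\times V(H)$ and edges $(u_1,v_1)(u_2,v_2)$ with either $u_1u_2\in E(G)$, $v_1=v_2$, or $v_1v_2\in E(H)$, $u_1=u_2$. A connected set of $G$ is a nonempty $C\subseteq V(G)$ with $G[C]$ connected; $\mathcal C(G)$ is the set of all connected sets and $N(G)=|\mathcal C(G)|$. $K_4\times P_k$ and $P_4\times P_k$ have the same vertex set $\{v_{i,j}:1\le i\le 4,\ 1\le j\le k\}$ ($i$ the coordinate in $K_4$ resp. $P_4$, where $v_{i_1,j}v_{i_2,j}$ is an edge of $P_4\times P_k$ iff $|i_1-i_2|=1$); the $j$-th column is $\{v_{1,j},v_{2,j},v_{3,j},v_{4,j}\}$. $N_{4,k}$ is the number of connected sets of $K_4\times P_k$ containing at least one vertex in each column; it is given by $N_{4,k}=\mathbf{u_2}\cdot T_2^{k-1}\mathbf 1$ with $\mathbf{u_2}=\begin{bmatrix}4&6&4&1\end{bmatrix}$, $\mathbf{1}$ the all-ones column vector, and $T_2=\begin{bmatrix}1&3&3&1\\2&5&4&1\\3&6&4&1\\4&6&4&1\end{bmatrix}$. $\mathcal C'_{4,k}$ is the set of elements of $\mathcal C(K_4\times P_k)\setminus\mathcal C(P_4\times P_k)$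 containing at least one vertex in each column. *)

theory Defs
  imports "Graph_Theory.Graph_Theory" "Jordan_Normal_Form.Matrix"
begin

text \<open>
  A simple graph is a symmetric loop-free pair digraph (locale \<^locale>\<open>pair_graph\<close>):
  an edge \<open>uv\<close> is represented by the two arcs \<open>(u, v)\<close> and \<open>(v, u)\<close>.
  Vertices are numbered from 1.
\<close>

definition complete_graph :: "nat \<Rightarrow> nat pair_pre_digraph" where
  "complete_graph m =
     \<lparr>pverts = {1..m}, parcs = {(u, v). u \<in> {1..m} \<and> v \<in> {1..m} \<and> u \<noteq> v}\<rparr>"

definition path_graph :: "nat \<Rightarrow> nat pair_pre_digraph" where
  "path_graph n =
     \<lparr>pverts = {1..n},
      parcs = {(u, v). u \<in> {1..n} \<and> v \<in> {1..n} \<and> (v = u + 1 \<or> u = v + 1)}\<rparr>"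

definition cartesian_product ::
  "'a pair_pre_digraph \<Rightarrow> 'b pair_pre_digraph \<Rightarrow> ('a \<times> 'b) pair_pre_digraph" where
  "cartesian_product G H =
     \<lparr>pverts = pverts G \<times> pverts H,
      parcs = {((u1, v1), (u2, v2)).
        (u1, u2) \<in> parcs G \<and> v1 = v2 \<and> v1 \<in> pverts H \<or>
        (v1, v2) \<in> parcs H \<and> u1 = u2 \<and> u1 \<in> pverts G}\<rparr>"

text \<open>The qualified name picks graph connectivity rather than the topological notion.\<close>

definition connected_sets :: "'a pair_pre_digraph \<Rightarrow> 'a set set" where
  "connected_sets G =
     {C. C \<subseteq> pverts G \<and> C \<noteq> {} \<and> Digraph_Component.connected (with_proj G \<restriction> C)}"

definition num_connected_sets :: "'a pair_pre_digraph \<Rightarrow> nat" where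
  "num_connected_sets G = card (connected_sets G)"

text \<open>The vertex \<open>v\<^sub>i\<^sub>,\<^sub>j\<close> is the pair \<open>(i, j)\<close>.\<close>

definition column :: "nat \<Rightarrow> (nat \<times> nat) set" where
  "column j = {1..4} \<times> {j}"

definition meets_all_columns :: "nat \<Rightarrow> (nat \<times> nat) set \<Rightarrow> bool" where
  "meets_all_columns k C \<longleftrightarrow> (\<forall>j\<in>{1..k}. C \<inter> column j \<noteq> {})"

definition N4 :: "nat \<Rightarrow> nat" where
  "N4 k = card {C \<in> connected_sets (cartesian_product (complete_graph 4) (path_graph k)).
                  meets_all_columns k C}"

definition C4' :: "nat \<Rightarrow> (nat \<times> nat) set set" where
  "C4' k =
     {C \<in> connected_sets (cartesian_product (complete_graph 4) (path_graph k))
          - connected_sets (cartesian_product (path_graph 4) (path_graph k)).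
        meets_all_columns k C}"

lemma pair_graph_complete_graph: "pair_graph (complete_graph m)"
proof -
  have "finite (parcs (complete_graph m))"
    by (rule finite_subset[of _ "{1..m} \<times> {1..m}"]) (auto simp: complete_graph_def)
  then show ?thesis
    by unfold_locales (auto simp: complete_graph_def symmetric_def sym_def)
qed

lemma complete_graph_is_complete_digraph: "complete_digraph m (with_proj (complete_graph m))"
proof -
  interpret pair_graph "complete_graph m" by (rule pair_graph_complete_graph)
  show ?thesis
    unfolding complete_digraph_def using graph_axioms
    by (auto simp: complete_graph_def intro: pair_graphD_graph)
qed

lemma pair_graph_path_graph: "pair_graph (path_graph n)"
proof -
  have "finite (parcs (path_graph n))"
    by (rule finite_subset[of _ "{1..n} \<times> {1..n}"]) (auto simp: path_graph_def)
  then show ?thesis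
    by unfold_locales (auto simp: path_graph_def symmetric_def sym_def)
qed

lemma pair_graph_cartesian_product:
  assumes "pair_graph G" "pair_graph H"
  shows "pair_graph (cartesian_product G H)"
proof -
  interpret G: pair_graph G by fact
  interpret H: pair_graph H by fact
  have "parcs (cartesian_product G H) \<subseteq> (pverts G \<times> pverts H) \<times> (pverts G \<times> pverts H)"
    by (auto simp: cartesian_product_def dest: G.in_arcsD1 G.in_arcsD2 H.in_arcsD1 H.in_arcsD2)
  then have "finite (parcs (cartesian_product G H))"
    by (rule finite_subset) (simp add: G.pair_finite_verts H.pair_finite_verts)
  then show ?thesis
    by unfold_locales
      (auto simp: cartesian_product_def symmetric_def sym_def G.pair_finite_verts H.pair_finite_verts
        dest: G.in_arcsD1 G.in_arcsD2 H.in_arcsD1 H.in_arcsD2 G.no_loops' H.no_loops'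
          G.arcs_symmetric H.arcs_symmetric)
qed

lemma connected_sets_conv:
  assumes "pair_graph G"
  shows "C \<in> connected_sets G \<longleftrightarrow> C \<subseteq> pverts G \<and> C \<noteq> {} \<and>
    (\<forall>u\<in>C. \<forall>v\<in>C. (u, v) \<in> (parcs G \<inter> C \<times> C)\<^sup>*)"
proof -
  interpret pair_graph G by fact
  let ?H = "with_proj G \<restriction> C"
  have ends: "arcs_ends ?H = parcs G \<inter> C \<times> C"
    by (auto simp: arcs_ends_conv)
  have symH: "symmetric ?H"
    unfolding symmetric_def ends by (auto simp: sym_def dest: arcs_symmetric)
  have wf: "wf_digraph ?H"
    by unfold_locales auto
  have "Digraph_Component.connected ?H \<longleftrightarrow> strongly_connected ?H"
  proof
    assume "Digraph_Component.connected ?H"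
    with wf symH show "strongly_connected ?H"
      by (intro wf_digraph.symmetric_connected_imp_strongly_connected)
  next
    assume sc: "strongly_connected ?H"
    have "(arcs_ends ?H)\<^sup>s = arcs_ends ?H"
      using symH by (auto simp: symmetric_def symcl_def sym_def)
    with sc show "Digraph_Component.connected ?H"
      unfolding connected_conv strongly_connected_def reachable_def by simp
  qed
  moreover have "u \<rightarrow>\<^sup>*\<^bsub>?H\<^esub> v \<longleftrightarrow> (u, v) \<in> (parcs G \<inter> C \<times> C)\<^sup>*" if "u \<in> C" for u v
    using wf_digraph.reachable_conv'[OF wf, of u v] that ends by simp
  ultimately show ?thesis
    by (auto simp: connected_sets_def strongly_connected_def)
qed

text \<open>
  The transfer-matrix formula for \<^const>\<open>N4\<close>, proved in \<open>N4_transfer_matrix\<close>. Each nonempty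
  column of \<open>K\<^sub>4 \<times> P\<^sub>k\<close> is a clique, so a set meeting all columns is connected iff
  consecutive columns share a row; row \<open>i\<close> and column \<open>j\<close> of \<open>T2\<close> count the \<open>j\<close>-subsets
  of \<open>{1..4}\<close> that meet a given \<open>i\<close>-subset.
\<close>

definition T2 :: "nat mat" where
  "T2 = mat_of_rows_list 4
     [[1, 3, 3, 1],
      [2, 5, 4, 1],
      [3, 6, 4, 1],
      [4, 6, 4, 1]]"

definition u2 :: "nat vec" where
  "u2 = vec_of_list [4, 6, 4, 1]"

definition col_of :: "(nat \<times> nat) set \<Rightarrow> nat \<Rightarrow> nat set" where
  "col_of C j = {i. (i, j) \<in> C}"

definition nonempty_rows :: "nat set set" where
  "nonempty_rows = Pow {1..4} - {{}}"

definition overlapping :: "nat \<Rightarrow> (nat \<times> nat) set set" where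
  "overlapping k = {C. C \<subseteq> {1..4} \<times> {1..k} \<and> (\<forall>j\<in>{1..k}. col_of C j \<noteq> {}) \<and>
     (\<forall>j\<in>{1..<k}. col_of C j \<inter> col_of C (Suc j) \<noteq> {})}"

abbreviation K4P :: "nat \<Rightarrow> (nat \<times> nat) pair_pre_digraph" where
  "K4P k \<equiv> cartesian_product (complete_graph 4) (path_graph k)"

lemma pair_graph_K4P: "pair_graph (K4P k)"
  by (intro pair_graph_cartesian_product pair_graph_complete_graph pair_graph_path_graph)

lemma pverts_K4P: "pverts (K4P k) = {1..4} \<times> {1..k}"
  by (simp add: cartesian_product_def complete_graph_def path_graph_def)

lemma parcs_K4P: "((a, b), (c, d)) \<in> parcs (K4P k) \<longleftrightarrow>
    a \<in> {1..4} \<and> c \<in> {1..4} \<and> b \<in> {1..k} \<and> d \<in> {1..k} \<and>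
    (a \<noteq> c \<and> b = d \<or> a = c \<and> (d = Suc b \<or> b = Suc d))"
  by (auto simp: cartesian_product_def complete_graph_def path_graph_def)

lemma connected_K4P_iff_overlapping:
  assumes "k \<ge> 1"
  shows "{C \<in> connected_sets (K4P k). meets_all_columns k C} = overlapping k"
proof (intro equalityI subsetI)
  fix C assume "C \<in> {C \<in> connected_sets (K4P k). meets_all_columns k C}"
  then have C: "C \<subseteq> {1..4} \<times> {1..k}" "meets_all_columns k C"
    and conn: "\<And>u v. u \<in> C \<Longrightarrow> v \<in> C \<Longrightarrow> (u, v) \<in> (parcs (K4P k) \<inter> C \<times> C)\<^sup>*"
    using connected_sets_conv[OF pair_graph_K4P, of C k] by (auto simp: pverts_K4P)
  have ne: "col_of C j \<noteq> {}" if "j \<in> {1..k}" for j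
    using C(2) that by (fastforce simp: meets_all_columns_def column_def col_of_def)
  have "col_of C j \<inter> col_of C (Suc j) \<noteq> {}" if j: "j \<in> {1..<k}" for j
  proof
    assume disj: "col_of C j \<inter> col_of C (Suc j) = {}"
    obtain a b where a: "(a, j) \<in> C" and b: "(b, Suc j) \<in> C"
      using ne[of j] ne[of "Suc j"] j by (auto simp: col_of_def)
    have "snd v \<le> j" if "((a, j), v) \<in> (parcs (K4P k) \<inter> C \<times> C)\<^sup>*" for v
      using that
    proof (induction rule: rtrancl_induct)
      case (step y z)
      obtain y1 y2 z1 z2 where yz: "y = (y1, y2)" "z = (z1, z2)" by (cases y, cases z)
      show ?case
      proof (rule ccontr)
        assume "\<not> ?thesis"
        with step yz have "y1 = z1" "y2 = j" "z2 = Suc j" "(y1, y2) \<in> C" "(z1, z2) \<in> C"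
          by (auto simp: parcs_K4P)
        with disj show False by (auto simp: col_of_def)
      qed
    qed simp
    from this[OF conn[OF a b]] show False by simp
  qed
  with C ne show "C \<in> overlapping k" by (auto simp: overlapping_def)
next
  fix C assume C: "C \<in> overlapping k"
  let ?R = "(parcs (K4P k) \<inter> C \<times> C)\<^sup>*"
  have sub: "C \<subseteq> {1..4} \<times> {1..k}" using C by (auto simp: overlapping_def)
  have same: "((a, j), (b, j)) \<in> ?R" if "(a, j) \<in> C" "(b, j) \<in> C" for a b j
  proof (cases "a = b")
    case False
    with that sub show ?thesis by (intro r_into_rtrancl) (auto simp: parcs_K4P)
  qed simp
  have symR: "(v, u) \<in> ?R" if "(u, v) \<in> ?R" for u v
  proof -
    have "sym (parcs (K4P k) \<inter> C \<times> C)"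
      by (auto simp: sym_def parcs_K4P)
    from sym_rtrancl[OF this] that show ?thesis by (auto dest: symD)
  qed
  have up: "((a, j), (b, j + d)) \<in> ?R" if "(a, j) \<in> C" "(b, j + d) \<in> C" for a b j d
    using that
  proof (induction d arbitrary: b)
    case 0
    then show ?case using same by simp
  next
    case (Suc d)
    have "j + d \<in> {1..<k}" using Suc.prems sub by auto
    with C obtain c where c: "(c, j + d) \<in> C" "(c, Suc (j + d)) \<in> C"
      unfolding overlapping_def col_of_def by blast
    have "((a, j), (c, j + d)) \<in> ?R" using Suc c by auto
    moreover have "((c, j + d), (c, Suc (j + d))) \<in> ?R"
      using c sub by (intro r_into_rtrancl) (auto simp: parcs_K4P)
    moreover have "((c, Suc (j + d)), (b, Suc (j + d))) \<in> ?R"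
      using c Suc.prems by (intro same) auto
    ultimately show ?case by (auto intro: rtrancl_trans)
  qed
  have conn: "((a, i), (b, j)) \<in> ?R" if "(a, i) \<in> C" "(b, j) \<in> C" for a b i j
  proof (cases "i \<le> j")
    case True
    with up[of a i b "j - i"] that show ?thesis by simp
  next
    case False
    with up[of b j a "i - j"] that symR show ?thesis by simp
  qed
  have meets: "meets_all_columns k C"
    unfolding meets_all_columns_def
  proof
    fix j assume "j \<in> {1..k}"
    with C obtain a where "(a, j) \<in> C" unfolding overlapping_def col_of_def by blast
    with sub show "C \<inter> column j \<noteq> {}" by (auto simp: column_def)
  qed
  moreover from meets assms have "C \<noteq> {}" by (auto simp: meets_all_columns_def)
  ultimately show "C \<in> {C \<in> connected_sets (K4P k). meets_all_columns k C}"
    using connected_sets_conv[OF pair_graph_K4P, of C k] sub conn by (auto simp: pverts_K4P)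
qed

text \<open>
  \<open>ending k A\<close>: sets with last column \<open>A\<close>; \<open>extensions m A\<close>: number of ways to append
  \<open>m\<close> further columns to a last column \<open>A\<close>.
\<close>

definition ending :: "nat \<Rightarrow> nat set \<Rightarrow> (nat \<times> nat) set set" where
  "ending k A = {C \<in> overlapping k. col_of C k = A}"

fun extensions :: "nat \<Rightarrow> nat set \<Rightarrow> nat" where
  "extensions 0 A = 1"
| "extensions (Suc m) A = (\<Sum>B | B \<in> nonempty_rows \<and> B \<inter> A \<noteq> {}. extensions m B)"

lemma finite_overlapping: "finite (overlapping k)"
  by (rule finite_subset[of _ "Pow ({1..4} \<times> {1..k})"]) (auto simp: overlapping_def)

lemma finite_nonempty_rows: "finite nonempty_rows"
  by (simp add: nonempty_rows_def)

lemma card_ending_1: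
  assumes "A \<in> nonempty_rows"
  shows "card (ending 1 A) = 1"
proof -
  have "ending 1 A = {A \<times> {1}}"
    using assms by (auto simp: ending_def overlapping_def col_of_def nonempty_rows_def)
  then show ?thesis by simp
qed

lemma card_ending_Suc:
  assumes "k \<ge> 1" "B \<in> nonempty_rows"
  shows "card (ending (Suc k) B) = (\<Sum>A | A \<in> nonempty_rows \<and> A \<inter> B \<noteq> {}. card (ending k A))"
proof -
  let ?S = "{A. A \<in> nonempty_rows \<and> A \<inter> B \<noteq> {}}"
  let ?U = "\<Union>A\<in>?S. ending k A"
  let ?f = "\<lambda>C. C \<union> B \<times> {Suc k}"
  have col_f: "col_of (?f C) j = (if j = Suc k then B else col_of C j)"
    if "C \<in> ?U" for C j
    using that by (auto simp: ending_def overlapping_def col_of_def)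
  have bij: "bij_betw ?f ?U (ending (Suc k) B)"
  proof (rule bij_betw_byWitness[where f' = "\<lambda>C. C \<inter> UNIV \<times> {1..k}"])
    show "\<forall>C\<in>?U. ?f C \<inter> UNIV \<times> {1..k} = C"
      by (auto simp: ending_def overlapping_def)
    show "\<forall>C\<in>ending (Suc k) B. ?f (C \<inter> UNIV \<times> {1..k}) = C"
      by (auto simp: ending_def overlapping_def col_of_def le_Suc_eq)
    show "?f ` ?U \<subseteq> ending (Suc k) B"
    proof (rule image_subsetI)
      fix C assume C: "C \<in> ?U"
      then obtain A where A: "A \<in> ?S" "C \<in> overlapping k" "col_of C k = A"
        by (auto simp: ending_def)
      have "?f C \<subseteq> {1..4} \<times> {1..Suc k}"
        using A assms(2) by (auto simp: overlapping_def nonempty_rows_def)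
      moreover have "col_of (?f C) j \<noteq> {}" if "j \<in> {1..Suc k}" for j
        using that A assms(2) unfolding col_f[OF C]
        by (auto simp: overlapping_def nonempty_rows_def le_Suc_eq)
      moreover have "col_of (?f C) j \<inter> col_of (?f C) (Suc j) \<noteq> {}" if "j \<in> {1..<Suc k}" for j
        using that A unfolding col_f[OF C]
        by (cases "j = k") (auto simp: overlapping_def)
      moreover have "col_of (?f C) (Suc k) = B"
        using col_f[OF C] by simp
      ultimately show "?f C \<in> ending (Suc k) B"
        unfolding ending_def overlapping_def by blast
    qed
    show "(\<lambda>C. C \<inter> UNIV \<times> {1..k}) ` ending (Suc k) B \<subseteq> ?U"
    proof (rule image_subsetI)
      fix C assume "C \<in> ending (Suc k) B"
      then have C: "C \<in> overlapping (Suc k)" "col_of C (Suc k) = B" by (auto simp: ending_def)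
      let ?D = "C \<inter> UNIV \<times> {1..k}"
      have col_D: "col_of ?D j = col_of C j" if "j \<in> {1..k}" for j
        using that by (auto simp: col_of_def)
      have "?D \<in> overlapping k"
        using C(1) col_D by (auto simp: overlapping_def)
      moreover have "col_of ?D k = col_of C k" using col_D assms(1) by auto
      moreover have "col_of C k \<in> ?S"
        using C assms(1)
        by (auto simp: overlapping_def nonempty_rows_def col_of_def)
      ultimately show "?D \<in> ?U" by (auto simp: ending_def)
    qed
  qed
  have "card (ending (Suc k) B) = card ?U"
    using bij_betw_same_card[OF bij] by simp
  also have "\<dots> = (\<Sum>A\<in>?S. card (ending k A))"
    by (rule card_UN_disjoint)
      (auto simp: finite_nonempty_rows ending_def intro: finite_subset[OF _ finite_overlapping[of k]])
  finally show ?thesis .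
qed

lemma sum_ending_extensions:
  "(\<Sum>A\<in>nonempty_rows. card (ending (Suc k) A) * extensions m A) =
     (\<Sum>A\<in>nonempty_rows. extensions (k + m) A)"
proof (induction k arbitrary: m)
  case 0
  show ?case using card_ending_1 by (intro sum.cong) auto
next
  case (Suc k)
  let ?e = "\<lambda>A. card (ending (Suc k) A)"
  let ?N = nonempty_rows
  have "(\<Sum>B\<in>?N. card (ending (Suc (Suc k)) B) * extensions m B) =
      (\<Sum>B\<in>?N. \<Sum>A | A \<in> ?N \<and> A \<inter> B \<noteq> {}. ?e A * extensions m B)"
    by (intro sum.cong refl) (simp add: card_ending_Suc sum_distrib_right)
  also have "\<dots> = (\<Sum>A\<in>?N. \<Sum>B | B \<in> ?N \<and> A \<inter> B \<noteq> {}. ?e A * extensions m B)"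
    by (rule sum.swap_restrict) (simp_all add: finite_nonempty_rows)
  also have "\<dots> = (\<Sum>A\<in>?N. ?e A * extensions (Suc m) A)"
    by (intro sum.cong refl) (simp add: sum_distrib_left Int_commute)
  also have "\<dots> = (\<Sum>A\<in>?N. extensions (k + Suc m) A)"
    by (rule Suc.IH)
  finally show ?case by simp
qed

lemma card_overlapping:
  "card (overlapping (Suc k)) = (\<Sum>A\<in>nonempty_rows. extensions k A)"
proof -
  have "overlapping (Suc k) = (\<Union>A\<in>nonempty_rows. ending (Suc k) A)"
    by (fastforce simp: ending_def overlapping_def nonempty_rows_def col_of_def)
  also have "card \<dots> = (\<Sum>A\<in>nonempty_rows. card (ending (Suc k) A))"
    by (rule card_UN_disjoint)
      (auto simp: finite_nonempty_rows ending_def intro: finite_subset[OF _ finite_overlapping[of "Suc k"]])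
  also have "\<dots> = (\<Sum>A\<in>nonempty_rows. extensions k A)"
    using sum_ending_extensions[of k 0] by simp
  finally show ?thesis .
qed

lemma sum_by_card:
  fixes f :: "nat \<Rightarrow> nat"
  assumes "X \<subseteq> nonempty_rows"
  shows "(\<Sum>B\<in>X. f (card B)) = (\<Sum>i = 1..4. card {B \<in> X. card B = i} * f i)"
proof -
  have fin: "finite X" using assms finite_nonempty_rows by (rule finite_subset)
  have img: "card ` X \<subseteq> {1..4}"
  proof (rule image_subsetI)
    fix B assume "B \<in> X"
    with assms have B: "B \<subseteq> {1..4}" "B \<noteq> {}" by (auto simp: nonempty_rows_def)
    then have "finite B" using finite_subset by blast
    with B card_mono[OF _ B(1)] show "card B \<in> {1..4}"
      by (auto simp: Suc_le_eq card_gt_0_iff)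
  qed
  have "(\<Sum>B\<in>X. f (card B)) = (\<Sum>i = 1..4. \<Sum>B | B \<in> X \<and> card B = i. f (card B))"
    using sum.group[OF fin _ img, of "\<lambda>B. f (card B)"] by simp
  then show ?thesis by simp
qed

lemma card_meeting:
  assumes "A \<in> nonempty_rows" "i \<ge> 1"
  shows "card {B \<in> {B \<in> nonempty_rows. B \<inter> A \<noteq> {}}. card B = i} =
    (4 choose i) - ((4 - card A) choose i)"
proof -
  let ?all = "{B. B \<subseteq> {1..4::nat} \<and> card B = i}"
  let ?dis = "{B. B \<subseteq> {1..4} - A \<and> card B = i}"
  have "{B \<in> {B \<in> nonempty_rows. B \<inter> A \<noteq> {}}. card B = i} = ?all - ?dis"
    using assms by (auto simp: nonempty_rows_def)
  moreover have "card (?all - ?dis) = card ?all - card ?dis"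
    by (rule card_Diff_subset) (auto intro: finite_subset[of _ "Pow {1..4}"])
  moreover have "card ({1..4} - A) = 4 - card A"
    using assms by (subst card_Diff_subset) (auto simp: nonempty_rows_def intro: finite_subset)
  ultimately show ?thesis by (simp add: n_subsets)
qed

lemma atLeastAtMost_1_4: "{1..4::nat} = {1, 2, 3, 4}" by auto

definition ext_vec :: "nat \<Rightarrow> nat vec" where
  "ext_vec m = (T2 ^\<^sub>m m) *\<^sub>v vec 4 (\<lambda>_. 1)"

lemma T2_carrier: "T2 \<in> carrier_mat 4 4"
  by (rule carrier_matI) (simp_all add: T2_def mat_of_rows_list_def)

lemma ext_vec_Suc: "ext_vec (Suc m) = T2 *\<^sub>v ext_vec m"
proof -
  have comm: "T2 ^\<^sub>m Suc j = T2 * T2 ^\<^sub>m j" for j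
  proof (induction j)
    case 0
    show ?case using T2_carrier by simp
  next
    case (Suc j)
    have "T2 ^\<^sub>m Suc (Suc j) = (T2 * T2 ^\<^sub>m j) * T2" using Suc by simp
    also have "\<dots> = T2 * T2 ^\<^sub>m Suc j"
      using T2_carrier by (simp add: assoc_mult_mat[of _ 4 4 _ 4 _ 4])
    finally show ?case .
  qed
  show ?thesis
    unfolding ext_vec_def comm using T2_carrier
    by (intro assoc_mult_mat_vec[of _ 4 4 _ 4]) auto
qed

lemma dim_ext_vec: "dim_vec (ext_vec m) = 4"
  using T2_carrier by (simp add: ext_vec_def)

lemma scalar_prod_4: "dim_vec w = 4 \<Longrightarrow> (v :: nat vec) \<bullet> w = v $ 0 * w $ 0 + v $ 1 * w $ 1 + v $ 2 * w $ 2 + v $ 3 * w $ 3"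
  by (simp add: scalar_prod_def numeral_eq_Suc)

lemma T2_mult:
  assumes "dim_vec w = 4"
  shows "(T2 *\<^sub>v w) $ 0 = 1 * w $ 0 + 3 * w $ 1 + 3 * w $ 2 + 1 * w $ 3"
    "(T2 *\<^sub>v w) $ 1 = 2 * w $ 0 + 5 * w $ 1 + 4 * w $ 2 + 1 * w $ 3"
    "(T2 *\<^sub>v w) $ 2 = 3 * w $ 0 + 6 * w $ 1 + 4 * w $ 2 + 1 * w $ 3"
    "(T2 *\<^sub>v w) $ 3 = 4 * w $ 0 + 6 * w $ 1 + 4 * w $ 2 + 1 * w $ 3"
  using assms by (simp_all add: T2_def mat_of_rows_list_def scalar_prod_4)

lemma extensions_eq:
  "A \<in> nonempty_rows \<Longrightarrow> extensions m A = ext_vec m $ (card A - 1)"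
proof (induction m arbitrary: A)
  case 0
  have "card A \<le> 4"
    using 0 card_mono[of "{1..4::nat}" A] by (auto simp: nonempty_rows_def)
  then have "card A - 1 < 4" by simp
  then show ?case using T2_carrier by (simp add: ext_vec_def)
next
  case (Suc m)
  have "finite A" "A \<noteq> {}" "card A \<le> 4"
    using Suc.prems card_mono[of "{1..4::nat}" A]
    by (auto simp: nonempty_rows_def intro: finite_subset)
  then have cA: "card A = 1 \<or> card A = 2 \<or> card A = 3 \<or> card A = 4"
    using card_gt_0_iff[of A] by linarith
  let ?X = "{B \<in> nonempty_rows. B \<inter> A \<noteq> {}}"
  have "extensions (Suc m) A = (\<Sum>B\<in>?X. ext_vec m $ (card B - 1))"
    using Suc.IH by (auto intro: sum.cong)
  also have "\<dots> = (\<Sum>i = 1..4. card {B \<in> ?X. card B = i} * ext_vec m $ (i - 1))"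
    by (rule sum_by_card) auto
  also have "\<dots> = (\<Sum>i = 1..4. ((4 choose i) - ((4 - card A) choose i)) * ext_vec m $ (i - 1))"
    using card_meeting[OF Suc.prems] by (intro sum.cong) auto
  also have "\<dots> = ext_vec (Suc m) $ (card A - 1)"
    unfolding ext_vec_Suc atLeastAtMost_1_4 using cA T2_mult[OF dim_ext_vec, of m]
    by (elim disjE) (simp_all add: binomial_eq_0 eval_nat_numeral)
  finally show ?case .
qed

lemma N4_transfer_matrix:
  assumes "k \<ge> 1"
  shows "N4 k = u2 \<bullet> ((T2 ^\<^sub>m (k - 1)) *\<^sub>v vec 4 (\<lambda>_. 1))"
proof -
  obtain m where k: "k = Suc m" using assms by (cases k) auto
  have card_rows: "card {B \<in> nonempty_rows. card B = i} = 4 choose i" if "i \<ge> 1" for i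
  proof -
    have "{B \<in> nonempty_rows. card B = i} = {B. B \<subseteq> {1..4} \<and> card B = i}"
      using that by (auto simp: nonempty_rows_def)
    then show ?thesis by (simp add: n_subsets)
  qed
  have "N4 k = card (overlapping (Suc m))"
    unfolding N4_def using connected_K4P_iff_overlapping[OF assms] k by simp
  also have "\<dots> = (\<Sum>A\<in>nonempty_rows. ext_vec m $ (card A - 1))"
    unfolding card_overlapping by (intro sum.cong) (auto simp: extensions_eq)
  also have "\<dots> = (\<Sum>i = 1..4. card {B \<in> nonempty_rows. card B = i} * ext_vec m $ (i - 1))"
    by (rule sum_by_card) auto
  also have "\<dots> = (\<Sum>i = 1..4. (4 choose i) * ext_vec m $ (i - 1))"
    using card_rows by (intro sum.cong) auto
  also have "\<dots> = u2 \<bullet> ext_vec m"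
    unfolding scalar_prod_4[OF dim_ext_vec] atLeastAtMost_1_4
    by (simp add: u2_def eval_nat_numeral)
  finally show ?thesis by (simp add: ext_vec_def k)
qed

end

theory Submission
  imports Defs
begin

text \<open>
  The columns met by a connected set of \<open>G \<times> P\<^sub>n\<close> form an interval, since adjacent vertices lie in
  equal or consecutive columns. Shifting a set that meets exactly \<open>k\<close> consecutive columns to the
  first \<open>k\<close> columns gives a connected set of \<open>G \<times> P\<^sub>k\<close> meeting all columns, and each such set
  arises from \<open>n - k + 1\<close> positions. For \<open>G = P\<^sub>4\<close> these sets are those counted by \<open>N\<^sub>4\<^sub>,\<^sub>k\<close> except
  the elements of \<open>C'\<^sub>4\<^sub>,\<^sub>k\<close>, because \<open>P\<^sub>4 \<times> P\<^sub>k\<close> is a spanning subgraph of \<open>K\<^sub>4 \<times> P\<^sub>k\<close>.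
\<close>

section \<open>Connectivity in the infinite strip\<close>

text \<open>Arcs of the product with an infinite path, which makes connectivity independent of \<open>n\<close>.\<close>

definition strip_arcs :: "'a pair_pre_digraph \<Rightarrow> (('a \<times> nat) \<times> ('a \<times> nat)) set" where
  "strip_arcs G = {((a, i), (b, j)).
     (a, b) \<in> parcs G \<and> i = j \<or> a = b \<and> (j = Suc i \<or> i = Suc j)}"

definition strip_connected :: "'a pair_pre_digraph \<Rightarrow> ('a \<times> nat) set \<Rightarrow> bool" where
  "strip_connected G C \<longleftrightarrow> (\<forall>u\<in>C. \<forall>v\<in>C. (u, v) \<in> (strip_arcs G \<inter> C \<times> C)\<^sup>*)"

definition shift_columns :: "nat \<Rightarrow> 'a \<times> nat \<Rightarrow> 'a \<times> nat" where
  "shift_columns a = apsnd (\<lambda>j. j + a)"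

text \<open>Projecting with \<open>snd\<close> expresses that every column is met for an arbitrary
  \<open>G\<close>; \<open>column\<close> is tied to four rows.\<close>

definition spanning_connected_sets :: "'a pair_pre_digraph \<Rightarrow> nat \<Rightarrow> ('a \<times> nat) set set" where
  "spanning_connected_sets G k =
     {C \<in> connected_sets (cartesian_product G (path_graph k)). snd ` C = {1..k}}"

text \<open>Between vertices of the product, its arcs are exactly the strip arcs, so the bound
  \<open>n\<close> survives only in the containment condition.\<close>

lemma connected_sets_product_path_iff:
  assumes "pair_graph G"
  shows "C \<in> connected_sets (cartesian_product G (path_graph n)) \<longleftrightarrow>
    C \<subseteq> pverts G \<times> {1..n} \<and> C \<noteq> {} \<and> strip_connected G C"
proof -
  have verts: "pverts (cartesian_product G (path_graph n)) = pverts G \<times> {1..n}"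
    by (simp add: cartesian_product_def path_graph_def)
  have arcs: "parcs (cartesian_product G (path_graph n)) \<inter> C \<times> C = strip_arcs G \<inter> C \<times> C"
    if "C \<subseteq> pverts G \<times> {1..n}"
    using that by (auto simp: cartesian_product_def path_graph_def strip_arcs_def)
  show ?thesis
    unfolding connected_sets_conv[OF pair_graph_cartesian_product[OF assms pair_graph_path_graph]]
      verts strip_connected_def
    using arcs by auto
qed

section \<open>Column shifts and column intervals\<close>

lemma inj_shift_columns: "inj (shift_columns a)"
  by (auto simp: inj_def shift_columns_def)

lemma snd_image_shift_columns: "snd ` shift_columns a ` C = (\<lambda>j. j + a) ` snd ` C"
  by (auto simp: shift_columns_def image_image)

text \<open>Walks are mapped arc by arc. Only arcs inside \<open>C\<close> have to be preserved,
  which admits maps such as truncated subtraction.\<close>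

lemma strip_connected_image:
  assumes "strip_connected G C"
    and "\<And>u v. u \<in> C \<Longrightarrow> v \<in> C \<Longrightarrow> (u, v) \<in> strip_arcs G \<Longrightarrow> (f u, f v) \<in> strip_arcs G"
  shows "strip_connected G (f ` C)"
proof -
  have "(f u, f v) \<in> (strip_arcs G \<inter> f ` C \<times> f ` C)\<^sup>*"
    if "(u, v) \<in> (strip_arcs G \<inter> C \<times> C)\<^sup>*" for u v
    using that
  proof (induction rule: rtrancl_induct)
    case (step v w)
    then have "(f v, f w) \<in> strip_arcs G \<inter> f ` C \<times> f ` C" using assms(2) by auto
    with step.IH show ?case by (rule rtrancl_into_rtrancl)
  qed simp
  with assms(1) show ?thesis
    by (auto simp: strip_connected_def)
qed

lemma strip_connected_shift_columns_iff:
  "strip_connected G (shift_columns a ` C) \<longleftrightarrow> strip_connected G C"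
proof
  assume "strip_connected G (shift_columns a ` C)"
  \<comment> \<open>All columns of the shifted set are at least \<open>a\<close>, so subtracting
    \<open>a\<close> never truncates and keeps adjacent columns adjacent.\<close>
  then have "strip_connected G (apsnd (\<lambda>j. j - a) ` shift_columns a ` C)"
    by (rule strip_connected_image) (auto simp: strip_arcs_def shift_columns_def)
  moreover have "apsnd (\<lambda>j. j - a) (shift_columns a p) = p" for p :: "'a \<times> nat"
    by (cases p) (simp add: shift_columns_def)
  ultimately show "strip_connected G C"
    by (simp add: image_image)
next
  assume "strip_connected G C"
  then show "strip_connected G (shift_columns a ` C)"
    by (rule strip_connected_image) (auto simp: strip_arcs_def shift_columns_def)
qed

text \<open>A discrete intermediate value argument: each arc of a walk changes the column by at most
  one.\<close>

lemma strip_connected_columns_interval: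
  assumes "strip_connected G C" "i \<in> snd ` C" "l \<in> snd ` C" "i \<le> j" "j \<le> l"
  shows "j \<in> snd ` C"
proof -
  obtain x y where xy: "(x, i) \<in> C" "(y, l) \<in> C" using assms by auto
  have "j \<in> snd ` C" if "((x, i), v) \<in> (strip_arcs G \<inter> C \<times> C)\<^sup>*" "j \<le> snd v" for v
    using that
  proof (induction rule: rtrancl_induct)
    case base
    with assms(2,4) show ?case by simp
  next
    case (step v w)
    show ?case
    proof (cases "j \<le> snd v")
      \<comment> \<open>The walk passes from below \<open>j\<close> to at least \<open>j\<close> in
        one arc, so it lands in column \<open>j\<close>.\<close>
      case False
      with step have "snd w = j" "w \<in> C" by (auto simp: strip_arcs_def)
      then show ?thesis by force
    qed (use step in blast)
  qed
  from this[of "(y, l)"] show ?thesis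
    using assms(1,5) xy by (simp add: strip_connected_def)
qed

section \<open>Decomposition by width and position\<close>

text \<open>Here \<open>k\<close> is the number of columns met and \<open>a\<close> the number of
  columns skipped before the first of them; the \<open>n - k + 1\<close> values of \<open>a\<close>
  give the weight in the sum.\<close>

lemma bij_betw_shift_spanning_connected_sets:
  assumes "pair_graph G"
  shows "bij_betw (\<lambda>(k, a, C). shift_columns a ` C)
    (SIGMA k:{1..n}. {0..n - k} \<times> spanning_connected_sets G k)
    (connected_sets (cartesian_product G (path_graph n)))"
    (is "bij_betw ?f ?A ?B")
  unfolding bij_betw_def
proof
  have cols: "snd ` shift_columns a ` C = {a + 1..a + k}"
    if "C \<in> spanning_connected_sets G k" for a k C
    using that
    by (simp add: snd_image_shift_columns spanning_connected_sets_def add.commute)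
  show "inj_on ?f ?A"
  proof (rule inj_onI)
    fix p q assume pq: "p \<in> ?A" "q \<in> ?A" "?f p = ?f q"
    obtain k a C l b D where p: "p = (k, a, C)" and q: "q = (l, b, D)"
      by (cases p, cases q)
    have k: "k \<in> {1..n}" and C: "C \<in> spanning_connected_sets G k"
      and D: "D \<in> spanning_connected_sets G l"
      and eq: "shift_columns a ` C = shift_columns b ` D"
      using pq by (simp_all add: p q)
    from arg_cong[OF eq, of "image snd"] have "{a + 1..a + k} = {b + 1..b + l}"
      by (simp only: cols[OF C] cols[OF D])
    \<comment> \<open>Equal intervals determine their endpoints unless both are empty, which
      \<open>k\<close> \<ge> 1 excludes.\<close>
    then have "a + 1 = b + 1 \<and> a + k = b + l"
      unfolding Icc_eq_Icc using k by auto
    then have "a = b" "k = l" by auto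
    moreover from this eq have "C = D"
      by (simp add: inj_image_eq_iff[OF inj_shift_columns])
    ultimately show "p = q" by (simp add: p q)
  qed
  show "?f ` ?A = ?B"
  proof (intro equalityI subsetI)
    fix X assume "X \<in> ?f ` ?A"
    then obtain k a C where kaC: "k \<in> {1..n}" "a \<le> n - k"
      and C: "C \<in> spanning_connected_sets G k" and X: "X = shift_columns a ` C"
      by auto
    have "C \<subseteq> pverts G \<times> {1..k}" "C \<noteq> {}" "strip_connected G C"
      using C connected_sets_product_path_iff[OF assms]
      by (auto simp: spanning_connected_sets_def)
    with kaC show "X \<in> ?B"
      unfolding X connected_sets_product_path_iff[OF assms] strip_connected_shift_columns_iff
      by (fastforce simp: shift_columns_def)
  next
    fix X assume "X \<in> ?B"
    then have X: "X \<subseteq> pverts G \<times> {1..n}" "X \<noteq> {}" "strip_connected G X"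
      using connected_sets_product_path_iff[OF assms] by auto
    have sub: "snd ` X \<subseteq> {1..n}" and ne: "snd ` X \<noteq> {}" using X by auto
    have fin: "finite (snd ` X)" using sub by (rule finite_subset) simp
    define i where "i = Min (snd ` X)"
    define l where "l = Max (snd ` X)"
    have il: "i \<in> snd ` X" "l \<in> snd ` X"
      using fin ne by (simp_all add: i_def l_def del: image_is_empty)
    have cX: "snd ` X = {i..l}"
    proof (intro equalityI subsetI)
      fix j assume "j \<in> snd ` X"
      then show "j \<in> {i..l}" using fin by (simp add: i_def l_def)
    next
      fix j assume "j \<in> {i..l}"
      then show "j \<in> snd ` X"
        using strip_connected_columns_interval[OF X(3) il] by simp
    qed
    have bounds: "1 \<le> i" "i \<le> l" "l \<le> n" using il sub cX by auto
    \<comment> \<open>Column \<open>i\<close> must move to column 1, so the offset is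
      \<open>i - 1\<close> and the width is \<open>l - i + 1\<close>.\<close>
    define a k where "a = i - 1" and "k = l - a"
    define C where "C = apsnd (\<lambda>j. j - a) ` X"
    have XC: "X = shift_columns a ` C"
    proof -
      have "shift_columns a (apsnd (\<lambda>j. j - a) p) = p" if "p \<in> X" for p
      proof -
        have "snd p \<in> {i..l}" using that cX by blast
        then show ?thesis by (cases p) (auto simp: shift_columns_def a_def)
      qed
      then show ?thesis by (simp add: C_def image_image)
    qed
    \<comment> \<open>Both sides equal \<open>{i..l}\<close>. Cancelling the injective translation
      avoids computing an image under truncated subtraction.\<close>
    have "(\<lambda>j. j + a) ` snd ` C = (\<lambda>j. j + a) ` {1..k}"
    proof -
      have "1 + a = i" "k + a = l" using bounds by (simp_all add: a_def k_def)
      with cX show ?thesis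
        unfolding XC snd_image_shift_columns image_add_atLeastAtMost' by (simp only:)
    qed
    then have cC: "snd ` C = {1..k}"
      by (simp only: inj_image_eq_iff[OF inj_on_add'])
    have "fst ` C \<subseteq> pverts G" using X(1) by (auto simp: C_def)
    then have "fst ` C \<times> snd ` C \<subseteq> pverts G \<times> {1..k}"
      unfolding cC by (rule Sigma_mono) simp
    with subset_fst_snd have "C \<subseteq> pverts G \<times> {1..k}" by (rule subset_trans)
    moreover have "C \<noteq> {}" using X(2) by (simp add: C_def)
    moreover have "strip_connected G C"
      using X(3) unfolding XC strip_connected_shift_columns_iff .
    ultimately have "C \<in> spanning_connected_sets G k"
      using cC by (simp add: spanning_connected_sets_def connected_sets_product_path_iff[OF assms])
    moreover have "k \<in> {1..n}" "a \<in> {0..n - k}" using bounds by (auto simp: a_def k_def)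
    ultimately show "X \<in> ?f ` ?A"
      using XC by (intro image_eqI[where x = "(k, a, C)"]) auto
  qed
qed

lemma finite_connected_sets:
  assumes "pair_graph G"
  shows "finite (connected_sets G)"
proof -
  interpret pair_graph G by fact
  show ?thesis
    by (rule finite_subset[of _ "Pow (pverts G)"])
      (auto simp: connected_sets_def pair_finite_verts)
qed

theorem num_connected_sets_product_path:
  assumes "pair_graph G"
  shows "num_connected_sets (cartesian_product G (path_graph n)) =
    (\<Sum>k = 1..n. card (spanning_connected_sets G k) * (n - k + 1))"
proof -
  have fin: "finite (spanning_connected_sets G k)" for k
    using finite_connected_sets[OF pair_graph_cartesian_product[OF assms pair_graph_path_graph]]
    by (simp add: spanning_connected_sets_def)
  show ?thesis
    unfolding num_connected_sets_def
      bij_betw_same_card[OF bij_betw_shift_spanning_connected_sets[OF assms], symmetric]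
    by (simp add: fin mult.commute)
qed

section \<open>Comparison of the path and complete graph products\<close>

lemma connected_sets_mono:
  assumes "pair_graph G" "pair_graph H" "pverts G \<subseteq> pverts H" "parcs G \<subseteq> parcs H"
  shows "connected_sets G \<subseteq> connected_sets H"
proof
  fix C assume C: "C \<in> connected_sets G"
  have "(parcs G \<inter> C \<times> C)\<^sup>* \<subseteq> (parcs H \<inter> C \<times> C)\<^sup>*"
    using assms(4) by (intro rtrancl_mono) auto
  with C assms(3) show "C \<in> connected_sets H"
    unfolding connected_sets_conv[OF assms(1)] connected_sets_conv[OF assms(2)] by blast
qed

lemma meets_all_columns_iff:
  assumes "C \<subseteq> {1..4} \<times> {1..k}"
  shows "meets_all_columns k C \<longleftrightarrow> snd ` C = {1..k}"
proof -
  have "C \<inter> column j \<noteq> {} \<longleftrightarrow> j \<in> snd ` C" for j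
    using assms by (force simp: column_def)
  with assms show ?thesis by (auto simp: meets_all_columns_def)
qed

text \<open>Adding edges preserves connectedness, so \<open>C4' k\<close> is the complement of the
  sets for the path product within those counted by \<open>N4 k\<close>.\<close>

lemma card_spanning_connected_sets_path4:
  "int (card (spanning_connected_sets (path_graph 4) k)) = int (N4 k) - int (card (C4' k))"
proof -
  let ?P = "cartesian_product (path_graph 4) (path_graph k)"
  let ?KC = "{C \<in> connected_sets (K4P k). meets_all_columns k C}"
  let ?PC = "{C \<in> connected_sets ?P. meets_all_columns k C}"
  have P: "pair_graph ?P"
    by (intro pair_graph_cartesian_product pair_graph_path_graph)
  have "connected_sets ?P \<subseteq> connected_sets (K4P k)"
    by (rule connected_sets_mono[OF P pair_graph_K4P])
      (auto simp: cartesian_product_def complete_graph_def path_graph_def)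
  then have sub: "?PC \<subseteq> ?KC" and diff: "C4' k = ?KC - ?PC"
    by (auto simp: C4'_def)
  have fin: "finite ?KC"
    using finite_connected_sets[OF pair_graph_K4P] by simp
  have "spanning_connected_sets (path_graph 4) k = ?PC"
    unfolding spanning_connected_sets_def
  proof (intro Collect_cong conj_cong refl)
    fix C assume "C \<in> connected_sets ?P"
    then have "C \<subseteq> {1..4} \<times> {1..k}"
      unfolding connected_sets_product_path_iff[OF pair_graph_path_graph]
      by (simp add: path_graph_def)
    then show "snd ` C = {1..k} \<longleftrightarrow> meets_all_columns k C"
      by (simp only: meets_all_columns_iff)
  qed
  moreover have "card (C4' k) = N4 k - card ?PC"
    unfolding diff N4_def using finite_subset[OF sub fin] sub by (rule card_Diff_subset)
  \<comment> \<open>This bound makes the natural-number subtraction above exact over the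
    integers.\<close>
  moreover have "card ?PC \<le> N4 k"
    unfolding N4_def using fin sub by (rule card_mono)
  ultimately show ?thesis by simp
qed

theorem theorem4p6:
  fixes n :: nat
  assumes "n \<ge> 1"
  shows "int (num_connected_sets (cartesian_product (path_graph 4) (path_graph n))) =
    (\<Sum>k = 1..n. (int (N4 k) - int (card (C4' k))) * (int n - int k + 1))"
proof -
  \<comment> \<open>Since \<open>k\<close> \<le> \<open>n\<close> in the range of summation, the
    subtraction does not truncate.\<close>
  have "int (n - k + 1) = int n - int k + 1" if "k \<in> {1..n}" for k
    using that by (simp add: of_nat_diff)
  then show ?thesis
    unfolding num_connected_sets_product_path[OF pair_graph_path_graph] of_nat_sum of_nat_mult
      card_spanning_connected_sets_path4
    by (intro sum.cong) simp_all
qed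

end
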